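(* Let $C$ be a bivariate copula whose coefficients of lower and upper tail dependence $\lambda_L^{C}$ and $\lambda_U^{C}$ exist, let $\alpha\in[0,1]$, and let $$C_\alpha(u,v)=C(u,v)+\frac{\alpha}{2}\big[\min(u,v)-\max(u+v-1,0)\big],\qquad (u,v)\in[0,1]^2.$$ Then the coefficients of lower and upper tail dependence of $C_\alpha$ are given, respectively, by $$\lambda_L^{C_\alpha}=\lambda_L^{C}+\frac{\alpha}{2}\qquad\text{and}\qquad \lambda_U^{C_\alpha}=\lambda_U^{C}+\frac{\alpha}{2}.$$
   Context: A bivariate copula is a function $C:[0,1]^2\to[0,1]$ with $C(u,0)=C(0,v)=0$, $C(u,1)=u$, $C(1,v)=v$ for all $u,v\in[0,1]$, and which is 2-increasing: $C(u_1,v_1)+C(u_2,v_2)-C(u_1,v_2)-C(u_2,v_1)\ge 0$ whenever $0\le u_1\le u_2\le1$, $0\le v_1\le v_2\le 1$. For a function $D$ on $[0,1]^2$ (here $D=C$ or $D=C_\alpha$), the coefficients of lower and upper tail dependence are the limits $\lambda_L^{D}=\lim_{u\to0^+}\frac{D(u,u)}{u}$ and $\lambda_U^{D}=\lim_{u\to1^-}\frac{1-2u+D(u,u)}{1-u}$, when they exist. *)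

theory Defs
  imports "HOL-Analysis.Analysis"
begin

(* Functions on the unit square are rendered as total functions real => real => real;
   only their values on [0,1] x [0,1] are constrained or used. *)

definition copula :: "(real \<Rightarrow> real \<Rightarrow> real) \<Rightarrow> bool" where
  "copula C \<longleftrightarrow>
     (\<forall>u\<in>{0..1}. \<forall>v\<in>{0..1}. C u v \<in> {0..1}) \<and>
     (\<forall>u\<in>{0..1}. C u 0 = 0 \<and> C u 1 = u) \<and>
     (\<forall>v\<in>{0..1}. C 0 v = 0 \<and> C 1 v = v) \<and>
     (\<forall>u1 u2 v1 v2. 0 \<le> u1 \<longrightarrow> u1 \<le> u2 \<longrightarrow> u2 \<le> 1 \<longrightarrow>
        0 \<le> v1 \<longrightarrow> v1 \<le> v2 \<longrightarrow> v2 \<le> 1 \<longrightarrow>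
        C u1 v1 + C u2 v2 - C u1 v2 - C u2 v1 \<ge> 0)"

definition lower_tail_exists :: "(real \<Rightarrow> real \<Rightarrow> real) \<Rightarrow> bool" where
  "lower_tail_exists D \<longleftrightarrow> (\<exists>l. ((\<lambda>u. D u u / u) \<longlongrightarrow> l) (at_right 0))"

definition upper_tail_exists :: "(real \<Rightarrow> real \<Rightarrow> real) \<Rightarrow> bool" where
  "upper_tail_exists D \<longleftrightarrow>
     (\<exists>l. ((\<lambda>u. (1 - 2 * u + D u u) / (1 - u)) \<longlongrightarrow> l) (at_left 1))"

(* Lim is an unspecified value when the limit does not exist, so the two coefficients below
   are meaningful only together with the corresponding existence predicate. *)

definition lower_tail_coeff :: "(real \<Rightarrow> real \<Rightarrow> real) \<Rightarrow> real" where
  "lower_tail_coeff D = Lim (at_right 0) (\<lambda>u. D u u / u)"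

definition upper_tail_coeff :: "(real \<Rightarrow> real \<Rightarrow> real) \<Rightarrow> real" where
  "upper_tail_coeff D = Lim (at_left 1) (\<lambda>u. (1 - 2 * u + D u u) / (1 - u))"

definition perturbed :: "real \<Rightarrow> (real \<Rightarrow> real \<Rightarrow> real) \<Rightarrow> real \<Rightarrow> real \<Rightarrow> real" where
  "perturbed \<alpha> C u v = C u v + \<alpha> / 2 * (min u v - max (u + v - 1) 0)"

end

theory Submission
  imports Defs
begin

text \<open>On the diagonal the added term is \<alpha>/2 times u - max(2u - 1, 0), which equals u
  below 1/2 and 1 - u above it. These are exactly the denominators of the two tail quotients, so
  near each endpoint the perturbation shifts the quotient by the constant \<alpha>/2, with no error
  term. \<open>perturbed_diag_lower\<close> and \<open>perturbed_diag_upper\<close> record this; the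
  limits, and hence the coefficients, shift by the same constant.\<close>

lemma perturbed_diag_lower:
  assumes "0 < u" "u < 1 / 2"
  shows "perturbed \<alpha> C u u / u = C u u / u + \<alpha> / 2"
  using assms by (simp add: perturbed_def field_simps)

text \<open>Above 1/2 the maximum is 2u - 1, so the bracket becomes u - (2u - 1) = 1 - u and cancels
  the denominator.\<close>

lemma perturbed_diag_upper:
  assumes "1 / 2 < u" "u < 1"
  shows "(1 - 2 * u + perturbed \<alpha> C u u) / (1 - u) = (1 - 2 * u + C u u) / (1 - u) + \<alpha> / 2"
proof -
  have "perturbed \<alpha> C u u = C u u + \<alpha> / 2 * (1 - u)"
    using assms by (simp add: perturbed_def)
  then have "1 - 2 * u + perturbed \<alpha> C u u = (1 - 2 * u + C u u) + \<alpha> / 2 * (1 - u)"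
    by simp
  also have "\<dots> / (1 - u) = (1 - 2 * u + C u u) / (1 - u) + \<alpha> / 2"
    using assms by (subst add_divide_distrib, subst nonzero_mult_div_cancel_right) simp_all
  finally show ?thesis .
qed

lemma perturbed_lower_tail_tendsto:
  assumes "((\<lambda>u. C u u / u) \<longlongrightarrow> l) (at_right 0)"
  shows "((\<lambda>u. perturbed \<alpha> C u u / u) \<longlongrightarrow> l + \<alpha> / 2) (at_right 0)"
proof (rule Lim_transform_eventually)
  show "((\<lambda>u. C u u / u + \<alpha> / 2) \<longlongrightarrow> l + \<alpha> / 2) (at_right 0)"
    using assms by (intro tendsto_intros)
  \<comment> \<open>The limit sees only points close to 0; the bound 1/2 is where max(2u - 1, 0)
    leaves the value 0.\<close>
  have "\<forall>\<^sub>F u in at_right (0::real). u \<in> {0<..<1/2}"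
    by (rule eventually_at_right_real) simp
  then show "\<forall>\<^sub>F u in at_right 0. C u u / u + \<alpha> / 2 = perturbed \<alpha> C u u / u"
    by eventually_elim (simp add: perturbed_diag_lower)
qed

lemma perturbed_upper_tail_tendsto:
  assumes "((\<lambda>u. (1 - 2 * u + C u u) / (1 - u)) \<longlongrightarrow> l) (at_left 1)"
  shows "((\<lambda>u. (1 - 2 * u + perturbed \<alpha> C u u) / (1 - u)) \<longlongrightarrow> l + \<alpha> / 2) (at_left 1)"
proof (rule Lim_transform_eventually)
  show "((\<lambda>u. (1 - 2 * u + C u u) / (1 - u) + \<alpha> / 2) \<longlongrightarrow> l + \<alpha> / 2) (at_left 1)"
    using assms by (rule tendsto_add) (rule tendsto_const)
  have "\<forall>\<^sub>F u in at_left (1::real). u \<in> {1/2<..<1}"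
    by (rule eventually_at_left_real) simp
  then show "\<forall>\<^sub>F u in at_left 1. (1 - 2 * u + C u u) / (1 - u) + \<alpha> / 2 =
      (1 - 2 * u + perturbed \<alpha> C u u) / (1 - u)"
    by eventually_elim (simp add: perturbed_diag_upper)
qed

text \<open>Limits are unique because the one-sided filter at 0 is nontrivial, so \<open>Lim\<close>
  returns the limit once convergence is known.\<close>

lemma lower_tail_coeff_eqI:
  "((\<lambda>u. D u u / u) \<longlongrightarrow> l) (at_right 0) \<Longrightarrow> lower_tail_coeff D = l"
  unfolding lower_tail_coeff_def by (rule tendsto_Lim) simp_all

lemma upper_tail_coeff_eqI:
  "((\<lambda>u. (1 - 2 * u + D u u) / (1 - u)) \<longlongrightarrow> l) (at_left 1) \<Longrightarrow> upper_tail_coeff D = l"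
  unfolding upper_tail_coeff_def by (rule tendsto_Lim) simp_all

theorem theorem2p6:
  fixes C :: "real \<Rightarrow> real \<Rightarrow> real" and \<alpha> :: real
  assumes "copula C"
    and "lower_tail_exists C" and "upper_tail_exists C"
    and "\<alpha> \<in> {0..1}"
  shows "lower_tail_exists (perturbed \<alpha> C) \<and>
         lower_tail_coeff (perturbed \<alpha> C) = lower_tail_coeff C + \<alpha> / 2 \<and>
         upper_tail_exists (perturbed \<alpha> C) \<and>
         upper_tail_coeff (perturbed \<alpha> C) = upper_tail_coeff C + \<alpha> / 2"
proof -
  obtain l where l: "((\<lambda>u. C u u / u) \<longlongrightarrow> l) (at_right 0)"
    using assms(2) unfolding lower_tail_exists_def by blast
  obtain m where m: "((\<lambda>u. (1 - 2 * u + C u u) / (1 - u)) \<longlongrightarrow> m) (at_left 1)"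
    using assms(3) unfolding upper_tail_exists_def by blast
  \<comment> \<open>\<open>C\<close> is instantiated by hand because unifying against
    \<open>C u u\<close>, with its repeated bound variable, has several solutions.\<close>
  note l' = perturbed_lower_tail_tendsto[where C = C, OF l, of \<alpha>]
  note m' = perturbed_upper_tail_tendsto[where C = C, OF m, of \<alpha>]
  have "lower_tail_exists (perturbed \<alpha> C)" "upper_tail_exists (perturbed \<alpha> C)"
    unfolding lower_tail_exists_def upper_tail_exists_def using l' m' by blast+
  then show ?thesis
    by (simp add: lower_tail_coeff_eqI[where D = C, OF l]
        lower_tail_coeff_eqI[where D = "perturbed \<alpha> C", OF l']
        upper_tail_coeff_eqI[where D = C, OF m]
        upper_tail_coeff_eqI[where D = "perturbed \<alpha> C", OF m'])
qed

end
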